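(* Let $\Sigma$ be a finite set and $L_I\subset\Sigma^{\ast}$ a regular language (the interval language of a regular evaluation $\alpha$). Then $(Q^-,\delta,q_{\mathrm{in}},Q^-_{\mathrm{t}})$ is the unique (up to isomorphism) minimal deterministic finite automaton for $L_I$, i.e. it accepts $L_I$ and is the unique deterministic automaton accepting $L_I$ with the smallest number of states.
   Context: $\mathbb{B}=\{0,1\mid 1+1=1\}$ is the Boolean semiring; a $\mathbb{B}$-semimodule is a commutative monoid $(M,+,0)$ with $a+a=a$. $\Sigma^{\ast}$ is the set of words in $\Sigma$; $\alpha_I:\Sigma^{\ast}\to\mathbb{B}$ is given by $\alpha_I(\omega)=1\Leftrightarrow\omega\in L_I$. The state space $A(-)$ is the quotient of the free $\mathbb{B}$-semimodule $\mathbb{B}[\Sigma^{\ast}]$ with basis $\Sigma^{\ast}$ by the relation $\sum_i\omega_i\sim\sum_j\omega'_j$ iff $\sum_i\alpha_I(\omega_iu)=\sum_j\alpha_I(\omega'_ju)$ for all $u\in\Sigma^{\ast}$. The class of a word $\omega$ is denoted $\langle\omega|$. Letters act on the right by $\langle\omega|a=\langle\omega a|$, and there is a well-defined homomorphism $\alpha_I:A(-)\to\mathbb{B}$ with $\alpha_I(\langle\omega|)=\alpha_I(\omega)$. Put $Q^-=\{\langle\omega| : \omega\in\Sigma^{\ast}\}\subset A(-)$ (classes of single words, not of their sums), $Q^-_{\mathrm{t}}=\{q\in Q^-:\alpha_I(q)=1\}$, $q_{\mathrm{in}}=\langle\emptyset|$ ($\emptyset$ is the empty word), and let $\delta:Q^-\times\Sigma\to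 Q^-$ be the action $\delta(\langle\omega|,a)=\langle\omega a|$. A deterministic finite automaton consists of a finite set $Q$ of states, an initial state $q_{\mathrm{in}}\in Q$, a subset $Q_{\mathrm{t}}\subset Q$ of accepting states, and an everywhere-defined transition map $\delta:Q\times\Sigma\to Q$; it accepts the language of words that take $q_{\mathrm{in}}$ to a state in $Q_{\mathrm{t}}$. An isomorphism of automata is a bijection of states respecting the initial state, transitions and accepting states. *)

theory Defs
  imports Main "HOL-Library.Poly_Mapping"
begin

datatype boolsr = BZero | BOne

instantiation boolsr :: comm_semiring_1
begin

definition zero_boolsr where "0 = BZero"
definition one_boolsr where "1 = BOne"

fun plus_boolsr where
  "plus_boolsr BZero b = b"
| "plus_boolsr BOne b = BOne"

fun times_boolsr where
  "times_boolsr BZero b = BZero"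
| "times_boolsr BOne b = b"

instance
proof
  fix a b c :: boolsr
  show "a + b + c = a + (b + c)" by (cases a; cases b; cases c) auto
  show "a + b = b + a" by (cases a; cases b) auto
  show "0 + a = a" by (simp add: zero_boolsr_def)
  show "a * b * c = a * (b * c)" by (cases a; cases b; cases c) auto
  show "a * b = b * a" by (cases a; cases b) auto
  show "1 * a = a" by (simp add: one_boolsr_def)
  show "(a + b) * c = a * c + b * c" by (cases a; cases b; cases c) auto
  show "0 * a = 0" by (simp add: zero_boolsr_def)
  show "a * 0 = 0" by (cases a) (auto simp: zero_boolsr_def)
  show "(0 :: boolsr) \<noteq> 1" by (simp add: zero_boolsr_def one_boolsr_def)
qed

end

lemma one_plus_one_boolsr: "1 + 1 = (1 :: boolsr)"
  by (simp add: one_boolsr_def)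

text \<open>
  Words over \<open>S\<close> are elements of \<^term>\<open>lists S\<close>. Finitely supported functions with values
  in \<^typ>\<open>boolsr\<close>, under pointwise addition, form the free semimodule on their index set; the
  word \<open>w\<close> as a basis element is \<open>Poly_Mapping.single w 1\<close>.
\<close>

definition free_words :: "'a set \<Rightarrow> ('a list \<Rightarrow>\<^sub>0 boolsr) set" where
  "free_words S = {x. Poly_Mapping.keys x \<subseteq> lists S}"

definition lin_ext :: "('b \<Rightarrow> boolsr) \<Rightarrow> ('b \<Rightarrow>\<^sub>0 boolsr) \<Rightarrow> boolsr" where
  "lin_ext f x = (\<Sum>w\<in>Poly_Mapping.keys x. Poly_Mapping.lookup x w * f w)"

definition append_letter :: "('a list \<Rightarrow>\<^sub>0 boolsr) \<Rightarrow> 'a \<Rightarrow> ('a list \<Rightarrow>\<^sub>0 boolsr)" where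
  "append_letter x a =
     (\<Sum>w\<in>Poly_Mapping.keys x. Poly_Mapping.single (w @ [a]) (Poly_Mapping.lookup x w))"

definition alpha :: "'a list set \<Rightarrow> 'a list \<Rightarrow> boolsr" where
  "alpha L w = (if w \<in> L then 1 else 0)"

definition state_rel ::
  "'a set \<Rightarrow> 'a list set \<Rightarrow> (('a list \<Rightarrow>\<^sub>0 boolsr) \<times> ('a list \<Rightarrow>\<^sub>0 boolsr)) set" where
  "state_rel S L = {(x, y). x \<in> free_words S \<and> y \<in> free_words S \<and>
     (\<forall>u\<in>lists S. lin_ext (\<lambda>w. alpha L (w @ u)) x = lin_ext (\<lambda>w. alpha L (w @ u)) y)}"

definition state_space :: "'a set \<Rightarrow> 'a list set \<Rightarrow> ('a list \<Rightarrow>\<^sub>0 boolsr) set set" where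
  "state_space S L = free_words S // state_rel S L"

definition word_class :: "'a set \<Rightarrow> 'a list set \<Rightarrow> 'a list \<Rightarrow> ('a list \<Rightarrow>\<^sub>0 boolsr) set" where
  "word_class S L w = state_rel S L `` {Poly_Mapping.single w 1}"

text \<open>
  The next two operations on classes are computed on representatives; independence of the
  representative is shown in \<open>alpha_state_class\<close> and \<open>act_state_class\<close> below.
\<close>

definition alpha_state :: "'a list set \<Rightarrow> ('a list \<Rightarrow>\<^sub>0 boolsr) set \<Rightarrow> boolsr" where
  "alpha_state L q = the_elem (lin_ext (alpha L) ` q)"

definition act_state ::
  "'a set \<Rightarrow> 'a list set \<Rightarrow> ('a list \<Rightarrow>\<^sub>0 boolsr) set \<Rightarrow> 'a \<Rightarrow> ('a list \<Rightarrow>\<^sub>0 boolsr) set" where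
  "act_state S L q a = (\<Union>x\<in>q. state_rel S L `` {append_letter x a})"

lemma equiv_state_rel: "equiv (free_words S) (state_rel S L)"
  by (rule equivI) (auto simp: state_rel_def refl_on_def sym_def trans_def)

lemma single_in_free_words: "w \<in> lists S \<Longrightarrow> Poly_Mapping.single w 1 \<in> free_words S"
  by (simp add: free_words_def)

lemma lin_ext_superset:
  assumes "finite A" "Poly_Mapping.keys x \<subseteq> A"
  shows "lin_ext f x = (\<Sum>w\<in>A. Poly_Mapping.lookup x w * f w)"
  unfolding lin_ext_def using assms
  by (intro sum.mono_neutral_left) (auto simp: in_keys_iff)

lemma lin_ext_add: "lin_ext f (x + y) = lin_ext f x + lin_ext f y"
proof -
  let ?A = "Poly_Mapping.keys x \<union> Poly_Mapping.keys y"
  have "finite ?A" by simp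
  moreover have "Poly_Mapping.keys (x + y) \<subseteq> ?A" by (rule Poly_Mapping.keys_add)
  ultimately show ?thesis
    by (simp add: lin_ext_superset[of ?A] lookup_add distrib_right sum.distrib)
qed

lemma state_rel_add:
  assumes "(x, x') \<in> state_rel S L" "(y, y') \<in> state_rel S L"
  shows "(x + y, x' + y') \<in> state_rel S L"
proof -
  have "u + v \<in> free_words S" if "u \<in> free_words S" "v \<in> free_words S"
    for u v :: "'a list \<Rightarrow>\<^sub>0 boolsr"
    using that Poly_Mapping.keys_add[of u v] unfolding free_words_def by blast
  then show ?thesis
    using assms by (simp add: state_rel_def lin_ext_add)
qed

lemma lin_ext_single: "lin_ext f (Poly_Mapping.single w b) = b * f w"
  by (simp add: lin_ext_def)

lemma lin_ext_sum: "lin_ext f (\<Sum>i\<in>I. g i) = (\<Sum>i\<in>I. lin_ext f (g i))"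
proof (induction I rule: infinite_finite_induct)
  case (insert i I)
  then show ?case by (simp add: lin_ext_add)
qed (simp_all add: lin_ext_def)

lemma lin_ext_append_letter: "lin_ext f (append_letter x a) = lin_ext (\<lambda>w. f (w @ [a])) x"
  unfolding append_letter_def by (simp add: lin_ext_sum lin_ext_single) (simp add: lin_ext_def)

lemma append_letter_single:
  "append_letter (Poly_Mapping.single w 1) a = Poly_Mapping.single (w @ [a]) 1"
  by (simp add: append_letter_def)

lemma append_letter_in_free_words:
  assumes "x \<in> free_words S" "a \<in> S"
  shows "append_letter x a \<in> free_words S"
proof -
  have "Poly_Mapping.keys (append_letter x a) \<subseteq>
      (\<Union>w\<in>Poly_Mapping.keys x. Poly_Mapping.keys
        (Poly_Mapping.single (w @ [a]) (Poly_Mapping.lookup x w)))"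
    unfolding append_letter_def by (rule Poly_Mapping.keys_sum)
  also have "\<dots> \<subseteq> lists S"
  proof (intro UN_least)
    fix w assume "w \<in> Poly_Mapping.keys x"
    then have "w @ [a] \<in> lists S"
      using assms unfolding free_words_def by (simp add: subset_iff)
    then show "Poly_Mapping.keys (Poly_Mapping.single (w @ [a]) (Poly_Mapping.lookup x w))
        \<subseteq> lists S"
      by simp
  qed
  finally show ?thesis by (simp add: free_words_def)
qed

lemma alpha_state_class:
  assumes "x \<in> free_words S"
  shows "alpha_state L (state_rel S L `` {x}) = lin_ext (alpha L) x"
proof -
  have "lin_ext (alpha L) y = lin_ext (alpha L) x" if "(x, y) \<in> state_rel S L" for y
  proof -
    have "\<forall>u\<in>lists S. lin_ext (\<lambda>w. alpha L (w @ u)) x = lin_ext (\<lambda>w. alpha L (w @ u)) y"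
      using that by (simp add: state_rel_def)
    from bspec[OF this, of "[]"] show ?thesis by simp
  qed
  moreover have "(x, x) \<in> state_rel S L"
    using assms by (simp add: state_rel_def)
  ultimately have "lin_ext (alpha L) ` (state_rel S L `` {x}) = {lin_ext (alpha L) x}"
    by blast
  then show ?thesis by (simp add: alpha_state_def)
qed

lemma append_letter_cong:
  assumes "(x, y) \<in> state_rel S L" "a \<in> S"
  shows "(append_letter x a, append_letter y a) \<in> state_rel S L"
proof -
  have "lin_ext (\<lambda>w. alpha L (w @ u)) (append_letter x a) =
        lin_ext (\<lambda>w. alpha L (w @ u)) (append_letter y a)" if "u \<in> lists S" for u
  proof -
    have "\<forall>v\<in>lists S. lin_ext (\<lambda>w. alpha L (w @ v)) x = lin_ext (\<lambda>w. alpha L (w @ v)) y"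
      using assms(1) by (simp add: state_rel_def)
    moreover have "a # u \<in> lists S" using that assms(2) by simp
    ultimately have "lin_ext (\<lambda>w. alpha L (w @ a # u)) x = lin_ext (\<lambda>w. alpha L (w @ a # u)) y"
      by (rule bspec)
    then show ?thesis by (simp add: lin_ext_append_letter)
  qed
  moreover have "x \<in> free_words S" "y \<in> free_words S"
    using assms(1) by (simp_all add: state_rel_def)
  ultimately show ?thesis
    using assms(2) by (simp add: state_rel_def append_letter_in_free_words)
qed

lemma act_state_class:
  assumes "x \<in> free_words S" "a \<in> S"
  shows "act_state S L (state_rel S L `` {x}) a = state_rel S L `` {append_letter x a}"
proof -
  have "(\<lambda>y. state_rel S L `` {append_letter y a}) respects state_rel S L"
    using append_letter_cong[OF _ assms(2)] equiv_class_eq[OF equiv_state_rel]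
    by (intro congruentI) blast
  then show ?thesis
    unfolding act_state_def by (rule UN_equiv_class[OF equiv_state_rel _ assms(1)])
qed

lemma alpha_state_word_class: "w \<in> lists S \<Longrightarrow> alpha_state L (word_class S L w) = alpha L w"
  unfolding word_class_def
  by (subst alpha_state_class) (auto simp: single_in_free_words lin_ext_single)

lemma act_state_word_class:
  "w \<in> lists S \<Longrightarrow> a \<in> S \<Longrightarrow> act_state S L (word_class S L w) a = word_class S L (w @ [a])"
  unfolding word_class_def
  by (subst act_state_class) (auto simp: single_in_free_words append_letter_single)

lemma word_class_in_state_space: "w \<in> lists S \<Longrightarrow> word_class S L w \<in> state_space S L"
  unfolding word_class_def state_space_def by (intro quotientI single_in_free_words)

record ('q, 'a) automaton =
  states :: "'q set"
  initial :: 'q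
  accepting :: "'q set"
  transition :: "'q \<Rightarrow> 'a \<Rightarrow> 'q"

definition dfa :: "'a set \<Rightarrow> ('q, 'a) automaton \<Rightarrow> bool" where
  "dfa S M \<longleftrightarrow> finite (states M) \<and> initial M \<in> states M \<and> accepting M \<subseteq> states M \<and>
     (\<forall>q\<in>states M. \<forall>a\<in>S. transition M q a \<in> states M)"

definition accepted_language :: "'a set \<Rightarrow> ('q, 'a) automaton \<Rightarrow> 'a list set" where
  "accepted_language S M = {w \<in> lists S. foldl (transition M) (initial M) w \<in> accepting M}"

definition automaton_iso ::
  "'a set \<Rightarrow> ('p, 'a) automaton \<Rightarrow> ('q, 'a) automaton \<Rightarrow> ('p \<Rightarrow> 'q) \<Rightarrow> bool" where
  "automaton_iso S M N f \<longleftrightarrow> bij_betw f (states M) (states N) \<and>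
     f (initial M) = initial N \<and>
     (\<forall>q\<in>states M. \<forall>a\<in>S. f (transition M q a) = transition N (f q) a) \<and>
     (\<forall>q\<in>states M. q \<in> accepting M \<longleftrightarrow> f q \<in> accepting N)"

definition isomorphic_automata ::
  "'a set \<Rightarrow> ('p, 'a) automaton \<Rightarrow> ('q, 'a) automaton \<Rightarrow> bool" where
  "isomorphic_automata S M N \<longleftrightarrow> (\<exists>f. automaton_iso S M N f)"

text \<open>
  Taking states in \<^typ>\<open>nat\<close> is no restriction, since every finite set is in bijection with a
  set of natural numbers.
\<close>

definition regular_language :: "'a set \<Rightarrow> 'a list set \<Rightarrow> bool" where
  "regular_language S L \<longleftrightarrow>
     (\<exists>M :: (nat, 'a) automaton. dfa S M \<and> accepted_language S M = L)"

definition Q_minus :: "'a set \<Rightarrow> 'a list set \<Rightarrow> ('a list \<Rightarrow>\<^sub>0 boolsr) set set" where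
  "Q_minus S L = word_class S L ` lists S"

definition state_automaton ::
  "'a set \<Rightarrow> 'a list set \<Rightarrow> (('a list \<Rightarrow>\<^sub>0 boolsr) set, 'a) automaton" where
  "state_automaton S L =
     \<lparr> states = Q_minus S L,
       initial = word_class S L [],
       accepting = {q \<in> Q_minus S L. alpha_state L q = 1},
       transition = act_state S L \<rparr>"

end

theory Submission
  imports Defs
begin

text \<open>
  Two words have the same class precisely when they have the same residual language with respect
  to \<open>L\<close> (Myhill--Nerode equivalence). In any automaton accepting \<open>L\<close>, words leading to the same
  state have the same residual, so sending the state reached by \<open>w\<close> to the class of \<open>w\<close> is a
  well-defined surjection from the reachable states onto \<open>Q\<^sup>-\<close>. If the automaton has no more
  states than \<open>Q\<^sup>-\<close>, then all its states are reachable and the surjection is an isomorphism.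
\<close>

definition run :: "('q, 'a) automaton \<Rightarrow> 'a list \<Rightarrow> 'q" where
  "run M w = foldl (transition M) (initial M) w"

lemma run_snoc: "run M (w @ [a]) = transition M (run M w) a"
  by (simp add: run_def)

lemma run_append_cong: "run M v = run M w \<Longrightarrow> run M (v @ u) = run M (w @ u)"
  by (simp add: run_def)

lemma accepted_language_run:
  "accepted_language S M = {w \<in> lists S. run M w \<in> accepting M}"
  by (simp add: accepted_language_def run_def)

lemma run_in_states:
  assumes "dfa S M" "w \<in> lists S"
  shows "run M w \<in> states M"
  using assms(2)
proof (induction w rule: rev_induct)
  case Nil
  then show ?case using assms(1) by (simp add: run_def dfa_def)
next
  case (snoc a w)
  then show ?case using assms(1) by (simp add: run_snoc dfa_def)
qed

text \<open>On a basis element, \<open>lin_ext\<close> is mere evaluation at the word, so the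
  relation defining the state space becomes Myhill--Nerode equivalence when restricted to single
  words.\<close>

lemma word_class_eq_iff:
  assumes "v \<in> lists S" "w \<in> lists S"
  shows "word_class S L v = word_class S L w \<longleftrightarrow>
    (\<forall>u\<in>lists S. v @ u \<in> L \<longleftrightarrow> w @ u \<in> L)"
proof -
  have "word_class S L v = word_class S L w \<longleftrightarrow>
      (Poly_Mapping.single v 1, Poly_Mapping.single w 1) \<in> state_rel S L"
    unfolding word_class_def
    by (rule eq_equiv_class_iff[OF equiv_state_rel])
      (use assms in \<open>simp_all add: single_in_free_words\<close>)
  also have "\<dots> \<longleftrightarrow> (\<forall>u\<in>lists S. v @ u \<in> L \<longleftrightarrow> w @ u \<in> L)"
    using assms by (auto simp: state_rel_def single_in_free_words lin_ext_single alpha_def)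
  finally show ?thesis .
qed

lemma word_class_eq_if_run_eq:
  assumes "accepted_language S M = L" "v \<in> lists S" "w \<in> lists S" "run M v = run M w"
  shows "word_class S L v = word_class S L w"
proof -
  have "v @ u \<in> L \<longleftrightarrow> w @ u \<in> L" if "u \<in> lists S" for u
    using assms(2,3) that run_append_cong[OF assms(4)]
    unfolding assms(1)[symmetric] by (simp add: accepted_language_run)
  then show ?thesis
    using assms(2,3) by (simp add: word_class_eq_iff)
qed

lemma run_state_automaton:
  "w \<in> lists S \<Longrightarrow> run (state_automaton S L) w = word_class S L w"
\<comment> \<open>Letters act on the right, so the last letter of the word is the one split
  off.\<close>
proof (induction w rule: rev_induct)
  case Nil
  show ?case by (simp add: run_def state_automaton_def)
next
  case (snoc a w)
  then have "run (state_automaton S L) (w @ [a]) = act_state S L (word_class S L w) a"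
    \<comment> \<open>The induction hypothesis is applied while \<open>state_automaton S L\<close>
      is still folded; only afterwards is its transition unfolded to
      \<open>act_state\<close>.\<close>
    by (simp add: run_snoc) (simp add: state_automaton_def)
  then show ?case
    using snoc.prems by (simp add: act_state_word_class)
qed

lemma word_class_accepting_iff:
  "w \<in> lists S \<Longrightarrow> word_class S L w \<in> accepting (state_automaton S L) \<longleftrightarrow> w \<in> L"
  by (auto simp: state_automaton_def Q_minus_def alpha_state_word_class alpha_def)

lemma accepted_language_state_automaton:
  "L \<subseteq> lists S \<Longrightarrow> accepted_language S (state_automaton S L) = L"
  \<comment> \<open>\<open>conj_cong\<close> makes \<open>w \<in> lists S\<close> available while
    the acceptance condition is rewritten; both rules for \<open>state_automaton\<close> require
    it.\<close>
  by (simp add: accepted_language_run run_state_automaton word_class_accepting_iff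
      subset_eq set_eq_iff cong: conj_cong) blast

text \<open>This is the comparison map from states to classes, given as a total function by choosing
  a word that leads to each state. Only its values at reachable states matter.\<close>

lemma obtain_state_to_word_class:
  assumes "accepted_language S M = L"
  obtains g where "\<And>w. w \<in> lists S \<Longrightarrow> g (run M w) = word_class S L w"
proof
  fix w assume w: "w \<in> lists S"
  \<comment> \<open>The word chosen for the state \<open>run M w\<close> may differ from
    \<open>w\<close>, but it leads to the same state and hence has the same class.\<close>
  let ?v = "SOME v. v \<in> lists S \<and> run M v = run M w"
  have "?v \<in> lists S \<and> run M ?v = run M w"
    using w by (intro someI) auto
  then have "word_class S L ?v = word_class S L w"
    using word_class_eq_if_run_eq[OF assms _ w] by blast
  then show "(\<lambda>q. word_class S L (SOME v. v \<in> lists S \<and> run M v = q)) (run M w) =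
      word_class S L w" .
qed

text \<open>The comparison map carries the reachable states onto \<open>Q_minus S L\<close>.
  Bounding by the reachable states, rather than by all of \<open>states M\<close>, later forces
  reachability when the cardinalities agree.\<close>

lemma finite_Q_minus_and_card_le:
  assumes "dfa S M" "accepted_language S M = L"
  shows "finite (Q_minus S L)" and "card (Q_minus S L) \<le> card (run M ` lists S)"
proof -
  obtain g where g: "\<And>w. w \<in> lists S \<Longrightarrow> g (run M w) = word_class S L w"
    using obtain_state_to_word_class[OF assms(2)] by blast
  have Q: "Q_minus S L = g ` run M ` lists S"
    using g by (simp add: Q_minus_def image_image)
  have "finite (run M ` lists S)"
    using assms(1) run_in_states[OF assms(1)]
    by (auto simp: dfa_def intro: finite_subset[of _ "states M"])
  then show "finite (Q_minus S L)" "card (Q_minus S L) \<le> card (run M ` lists S)"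
    by (simp_all add: Q card_image_le)
qed

text \<open>Regularity supplies finiteness, through any automaton for \<open>L\<close>; closure
  under transitions holds because acting by a letter on the class of a word extends the
  word.\<close>

lemma dfa_state_automaton:
  assumes "regular_language S L"
  shows "dfa S (state_automaton S L)"
proof -
  have "finite (Q_minus S L)"
    using assms finite_Q_minus_and_card_le(1) unfolding regular_language_def by blast
  moreover have "act_state S L q a \<in> Q_minus S L" if "q \<in> Q_minus S L" "a \<in> S" for q a
  proof -
    obtain w where "w \<in> lists S" "q = word_class S L w"
      using \<open>q \<in> Q_minus S L\<close> unfolding Q_minus_def by blast
    then show ?thesis
      using \<open>a \<in> S\<close> by (simp add: Q_minus_def act_state_word_class)
  qed
  ultimately show ?thesis
    by (auto simp: dfa_def state_automaton_def Q_minus_def)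
qed

text \<open>The comparison map goes out of \<open>M\<close>, while uniqueness is stated in the other
  direction. The inverse bijection undoes \<open>f\<close> only on \<open>states M\<close>;
  \<open>dfa S M\<close> places the initial state and all successors there.\<close>

lemma isomorphic_automata_sym:
  assumes "dfa S M" "isomorphic_automata S M N"
  shows "isomorphic_automata S N M"
proof -
  obtain f where f: "automaton_iso S M N f"
    using assms(2) by (auto simp: isomorphic_automata_def)
  have bij: "bij_betw f (states M) (states N)"
    using f by (simp add: automaton_iso_def)
  define g where "g = inv_into (states M) f"
  have gf: "g (f q) = q" if "q \<in> states M" for q
    using bij that by (simp add: g_def bij_betw_inv_into_left)
  have N: "states N = f ` states M"
    using bij by (simp add: bij_betw_imp_surj_on)
  have "bij_betw g (states N) (states M)"
    using bij by (simp add: g_def bij_betw_inv_into)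
  moreover have "g (initial N) = initial M"
    using f assms(1) gf[of "initial M"] by (simp add: automaton_iso_def dfa_def)
  moreover have "g (transition N p a) = transition M (g p) a"
    if p: "p \<in> states N" and a: "a \<in> S" for p a
  proof -
    obtain q where q: "q \<in> states M" "p = f q" using p N by auto
    then have "transition N p a = f (transition M q a)"
      using f a by (simp add: automaton_iso_def)
    moreover have "transition M q a \<in> states M"
      using assms(1) q(1) a by (simp add: dfa_def)
    ultimately show ?thesis by (simp add: gf q)
  qed
  moreover have "p \<in> accepting N \<longleftrightarrow> g p \<in> accepting M" if "p \<in> states N" for p
    using that f gf by (auto simp: N automaton_iso_def)
  ultimately show ?thesis
    by (auto simp: isomorphic_automata_def automaton_iso_def)
qed

lemma isomorphic_state_automaton:
  assumes M: "dfa S M" and L: "accepted_language S M = L"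
    and card: "card (states M) = card (Q_minus S L)"
  shows "isomorphic_automata S M (state_automaton S L)"
proof -
  obtain g where g: "\<And>w. w \<in> lists S \<Longrightarrow> g (run M w) = word_class S L w"
    using obtain_state_to_word_class[OF L] by blast
  have fin: "finite (states M)"
    using M by (simp add: dfa_def)
  \<comment> \<open>The reachable states form a subset of the finite set \<open>states M\<close>
    with at least \<open>card (Q_minus S L) = card (states M)\<close> elements, so they exhaust
    it.\<close>
  have reach: "run M ` lists S = states M"
    using finite_Q_minus_and_card_le(2)[OF M L] run_in_states[OF M] card fin
    by (intro card_seteq) auto
  have img: "g ` states M = Q_minus S L"
    using g by (simp add: Q_minus_def image_image flip: reach)
  \<comment> \<open>A map of a finite set onto a set of equal cardinality is injective.\<close>
  then have "inj_on g (states M)"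
    using fin card by (simp add: eq_card_imp_inj_on)
  then have "bij_betw g (states M) (states (state_automaton S L))"
    using img by (simp add: bij_betw_def state_automaton_def)
  moreover have "g (initial M) = initial (state_automaton S L)"
    using g[of "[]"] by (simp add: run_def state_automaton_def)
  moreover have "g (transition M q a) = transition (state_automaton S L) (g q) a"
    if "q \<in> states M" "a \<in> S" for q a
  proof -
    \<comment> \<open>By reachability every state is \<open>run M w\<close> for some word
      \<open>w\<close>, so transitions can be checked on words, where \<open>g\<close> is
      known.\<close>
    have "q \<in> run M ` lists S" using that(1) reach by simp
    then obtain w where w: "w \<in> lists S" "q = run M w" by blast
    then have "g (transition M q a) = word_class S L (w @ [a])"
      using g[of "w @ [a]"] that(2) by (simp add: run_snoc)
    also have "\<dots> = transition (state_automaton S L) (g q) a"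
      using w g that(2) by (simp add: state_automaton_def act_state_word_class)
    finally show ?thesis .
  qed
  moreover have "q \<in> accepting M \<longleftrightarrow> g q \<in> accepting (state_automaton S L)"
    if "q \<in> states M" for q
  proof -
    have "q \<in> run M ` lists S" using that reach by simp
    then obtain w where w: "w \<in> lists S" "q = run M w" by blast
    then have "q \<in> accepting M \<longleftrightarrow> w \<in> L"
      unfolding L[symmetric] by (simp add: accepted_language_run)
    then show ?thesis
      using w g by (simp add: word_class_accepting_iff)
  qed
  ultimately show ?thesis
    by (auto simp: isomorphic_automata_def automaton_iso_def)
qed

theorem proposition4p1:
  fixes S :: "'a set" and L :: "'a list set"
  assumes "finite S" and "L \<subseteq> lists S" and "regular_language S L"
  shows "dfa S (state_automaton S L) \<and>
    accepted_language S (state_automaton S L) = L \<and>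
    (\<forall>M :: ('q, 'a) automaton. dfa S M \<and> accepted_language S M = L \<longrightarrow>
      card (states (state_automaton S L)) \<le> card (states M) \<and>
      (card (states M) = card (states (state_automaton S L)) \<longrightarrow>
        isomorphic_automata S (state_automaton S L) M))"
proof (intro conjI allI impI)
  show "dfa S (state_automaton S L)"
    using assms(3) by (rule dfa_state_automaton)
  show "accepted_language S (state_automaton S L) = L"
    using assms(2) by (rule accepted_language_state_automaton)
next
  fix M :: "('q, 'a) automaton"
  assume "dfa S M \<and> accepted_language S M = L"
  then have M: "dfa S M" and L: "accepted_language S M = L" by simp_all
  \<comment> \<open>The number of reachable states lies between \<open>card (Q_minus S L)\<close>
    and \<open>card (states M)\<close>, which gives minimality.\<close>
  have "card (run M ` lists S) \<le> card (states M)"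
    using M run_in_states[OF M] by (intro card_mono) (auto simp: dfa_def)
  then show "card (states (state_automaton S L)) \<le> card (states M)"
    using finite_Q_minus_and_card_le(2)[OF M L] by (simp add: state_automaton_def)
  assume "card (states M) = card (states (state_automaton S L))"
  then have "isomorphic_automata S M (state_automaton S L)"
    using M L by (intro isomorphic_state_automaton) (simp_all add: state_automaton_def)
  then show "isomorphic_automata S (state_automaton S L) M"
    by (rule isomorphic_automata_sym[OF M])
qed

end
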